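(* Let $\mathcal{A}$ and $\mathcal{B}$ be commutative, associative, unital, finite-dimensional real algebras, $\Psi:\mathcal{A}\to\mathcal{B}$ an isomorphism of algebras, and $a_0,a_1,\dots,a_n\in\mathcal{A}$. Then an ($n$-times) $\mathcal{A}$-differentiable function $\eta:\mathcal{A}\to\mathcal{A}$ solves $$a_n\eta^{(n)}+\cdots+a_1\eta'+a_0\eta=0$$ if and only if $w=\Psi\circ\eta\circ\Psi^{-1}:\mathcal{B}\to\mathcal{B}$ is ($n$-times) $\mathcal{B}$-differentiable and solves $$\Psi(a_n)w^{(n)}+\cdots+\Psi(a_1)w'+\Psi(a_0)w=0.$$
   Context: For such an algebra $\mathcal{A}$ and $U\subseteq\mathcal{A}$ open, $f:U\to\mathcal{A}$ is $\mathcal{A}$-differentiable at $p$ if there is a real-linear map $d_pf:\mathcal{A}\to\mathcal{A}$ with $d_pf(xy)=d_pf(x)y$ for all $x,y\in\mathcal{A}$ and $\lim_{h\to0}\frac{f(p+h)-f(p)-d_pf(h)}{\|h\|}=0$ (any norm); then $f'(p)=d_pf(1)$ and $f^{(k)}=(f^{(k-1)})'$; likewise over $\mathcal{B}$. Derivatives of $\eta$ are $\mathcal{A}$-derivatives and derivatives of $w$ are $\mathcal{B}$-derivatives. *)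

theory Defs
  imports "HOL-Analysis.Analysis"
begin

text \<open>
  A commutative, associative, unital real algebra is a type of sort
  \<open>{real_normed_vector, real_algebra, comm_ring, comm_monoid_mult}\<close>.  The norm is an arbitrary
  vector space norm: it is only used for limits and need not be submultiplicative (the sort does not
  contain \<open>real_normed_algebra\<close>).  Using \<open>comm_monoid_mult\<close> rather than \<open>comm_ring_1\<close> for the unit
  keeps the zero algebra, where \<open>1 = 0\<close>.
\<close>

definition finite_dimensional :: "'a::real_vector itself \<Rightarrow> bool" where
  "finite_dimensional _ \<longleftrightarrow> (\<exists>B::'a set. finite B \<and> span B = UNIV)"

definition algebra_iso ::
  "('a::{real_algebra, comm_ring, comm_monoid_mult} \<Rightarrow>
    'b::{real_algebra, comm_ring, comm_monoid_mult}) \<Rightarrow> bool" where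
  "algebra_iso \<Psi> \<longleftrightarrow>
     linear \<Psi> \<and> bij \<Psi> \<and> (\<forall>x y. \<Psi> (x * y) = \<Psi> x * \<Psi> y) \<and> \<Psi> 1 = 1"

text \<open>
  \<open>has_derivative\<close> asks for a bounded linear map; on a finite-dimensional algebra every
  linear map is bounded.  Functions are total, so the open domain \<open>U\<close> is everything.
\<close>

definition has_alg_differential ::
  "('a::{real_normed_vector, real_algebra, comm_ring, comm_monoid_mult} \<Rightarrow> 'a) \<Rightarrow>
    ('a \<Rightarrow> 'a) \<Rightarrow> 'a \<Rightarrow> bool" where
  "has_alg_differential f D p \<longleftrightarrow>
     (f has_derivative D) (at p) \<and> (\<forall>x y. D (x * y) = D x * y)"

definition alg_differentiable ::
  "('a::{real_normed_vector, real_algebra, comm_ring, comm_monoid_mult} \<Rightarrow> 'a) \<Rightarrow> 'a \<Rightarrow> bool" where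
  "alg_differentiable f p \<longleftrightarrow> (\<exists>D. has_alg_differential f D p)"

definition alg_deriv ::
  "('a::{real_normed_vector, real_algebra, comm_ring, comm_monoid_mult} \<Rightarrow> 'a) \<Rightarrow> 'a \<Rightarrow> 'a" where
  "alg_deriv f p = (THE D. has_alg_differential f D p) 1"

lemma alg_deriv_eq: "has_alg_differential f D p \<Longrightarrow> alg_deriv f p = D 1"
  unfolding alg_deriv_def
  by (rule arg_cong[where f = "\<lambda>D. D 1"], rule the_equality)
     (auto simp: has_alg_differential_def intro: has_derivative_unique)

definition n_times_alg_differentiable ::
  "nat \<Rightarrow> ('a::{real_normed_vector, real_algebra, comm_ring, comm_monoid_mult} \<Rightarrow> 'a) \<Rightarrow> bool" where
  "n_times_alg_differentiable n f \<longleftrightarrow>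
     (\<forall>k<n. \<forall>p. alg_differentiable ((alg_deriv ^^ k) f) p)"

definition solves_linear_ode ::
  "nat \<Rightarrow> (nat \<Rightarrow> 'a::{real_normed_vector, real_algebra, comm_ring, comm_monoid_mult}) \<Rightarrow>
    ('a \<Rightarrow> 'a) \<Rightarrow> bool" where
  "solves_linear_ode n a f \<longleftrightarrow> (\<forall>z. (\<Sum>k\<le>n. a k * (alg_deriv ^^ k) f z) = 0)"

end

theory Submission
  imports Defs
begin

text \<open>
  Linear maps out of a finite-dimensional normed space are bounded, so \<open>\<Psi>\<close> and its inverse are
  their own derivatives and the chain rule turns an \<open>\<A>\<close>-differential \<open>D\<close> of \<open>f\<close> at \<open>p\<close> into the
  \<open>\<B>\<close>-differential \<open>\<Psi> \<circ> D \<circ> \<Psi>\<inverse>\<close> of \<open>\<Psi> \<circ> f \<circ> \<Psi>\<inverse>\<close> at \<open>\<Psi> p\<close>.  Hence conjugation by \<open>\<Psi>\<close> commutes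
  with taking derivatives, and \<open>\<Psi>\<close> maps the left-hand side of the first equation to that of the second.
\<close>

section \<open>Completeness of finitely generated spans and boundedness of linear maps on
  them\<close>

lemma coefficient_bound_complete_subspace:
  fixes b :: "'a::real_normed_vector"
  assumes "subspace S" "complete S" "b \<notin> S"
  obtains d where "d > 0" "\<And>x t. x - t *\<^sub>R b \<in> S \<Longrightarrow> \<bar>t\<bar> * d \<le> norm x"
proof -
  have "open (- S)"
    using complete_imp_closed[OF assms(2)] by (rule open_Compl)
  then obtain d where d: "d > 0" "ball b d \<subseteq> - S"
    using assms(3) open_contains_ball by blast
  have "\<bar>t\<bar> * d \<le> norm x" if "x - t *\<^sub>R b \<in> S" for x t
  proof (cases "t = 0")
    case False
    \<comment> \<open>Rescaling makes the coefficient of \<open>b\<close> equal to 1. The resulting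
      point of \<open>S\<close> lies outside the ball of radius \<open>d\<close> around
      \<open>b\<close>, and its distance from \<open>b\<close> is the norm of \<open>x\<close>
      divided by \<open>\<bar>t\<bar>\<close>.\<close>
    have "(- inverse t) *\<^sub>R (x - t *\<^sub>R b) \<in> S"
      by (rule subspace_scale[OF assms(1) that])
    then have "b - inverse t *\<^sub>R x \<in> S"
      using False by (simp add: algebra_simps)
    then have "d \<le> dist b (b - inverse t *\<^sub>R x)"
      using d(2) by (force simp: subset_iff)
    also have "\<dots> = norm x / \<bar>t\<bar>"
      by (simp add: dist_norm divide_inverse mult.commute)
    finally show ?thesis
      using False by (simp add: field_simps)
  qed simp
  then show thesis
    using d(1) that by blast
qed

text \<open>If \<open>b\<close> is outside \<open>span B\<close>, the coefficient bound makes the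
  \<open>b\<close>-coefficients of a Cauchy sequence Cauchy in the reals. Subtracting the
  \<open>b\<close>-components then leaves a Cauchy sequence in the complete space
  \<open>span B\<close>, and the two limits add up.\<close>

lemma complete_span_insert:
  fixes b :: "'a::real_normed_vector"
  assumes "complete (span B)"
  shows "complete (span (insert b B))"
proof (cases "b \<in> span B")
  case True
  then show ?thesis
    using assms by (simp add: span_redundant)
next
  case False
  then obtain d where d: "d > 0" "\<And>x t. x - t *\<^sub>R b \<in> span B \<Longrightarrow> \<bar>t\<bar> * d \<le> norm x"
    using coefficient_bound_complete_subspace[OF subspace_span assms] by blast
  show ?thesis
  proof (rule completeI)
    fix x :: "nat \<Rightarrow> 'a"
    assume "\<forall>n. x n \<in> span (insert b B)" and x: "Cauchy x"
    then obtain t where t: "\<And>n. x n - t n *\<^sub>R b \<in> span B"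
      unfolding span_breakdown_eq by metis
    have bound: "\<bar>t m - t n\<bar> * d \<le> norm (x m - x n)" for m n
      using d(2)[of "x m - x n" "t m - t n"] span_diff[OF t[of m] t[of n]]
      by (simp add: algebra_simps)
    have "Cauchy t"
    proof (rule metric_CauchyI)
      fix e :: real
      assume "e > 0"
      then obtain M where M: "\<And>m n. m \<ge> M \<Longrightarrow> n \<ge> M \<Longrightarrow> dist (x m) (x n) < e * d"
        using metric_CauchyD[OF x, of "e * d"] d(1) by auto
      have "dist (t m) (t n) < e" if "m \<ge> M" "n \<ge> M" for m n
      proof -
        have "\<bar>t m - t n\<bar> * d < e * d"
          using bound[of m n] M[OF that] by (simp add: dist_norm)
        then show ?thesis
          using d(1) by (simp add: dist_real_def)
      qed
      then show "\<exists>M. \<forall>m\<ge>M. \<forall>n\<ge>M. dist (t m) (t n) < e"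
        by blast
    qed
    then obtain s where s: "t \<longlonglongrightarrow> s"
      using Cauchy_convergent convergent_def by blast
    have tb: "(\<lambda>n. t n *\<^sub>R b) \<longlonglongrightarrow> s *\<^sub>R b"
      by (intro tendsto_intros s)
    have "Cauchy (\<lambda>n. x n - t n *\<^sub>R b)"
    proof (rule metric_CauchyI)
      fix e :: real
      assume "e > 0"
      then have "e / 2 > 0"
        by simp
      obtain M where M: "\<And>m n. m \<ge> M \<Longrightarrow> n \<ge> M \<Longrightarrow> dist (x m) (x n) < e / 2"
        using metric_CauchyD[OF x \<open>e / 2 > 0\<close>] by blast
      obtain N where
        N: "\<And>m n. m \<ge> N \<Longrightarrow> n \<ge> N \<Longrightarrow> dist (t m *\<^sub>R b) (t n *\<^sub>R b) < e / 2"
        using metric_CauchyD[OF LIMSEQ_imp_Cauchy[OF tb] \<open>e / 2 > 0\<close>] by blast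
      have "dist (x m - t m *\<^sub>R b) (x n - t n *\<^sub>R b) < e"
        if "m \<ge> max M N" "n \<ge> max M N" for m n
        using norm_diff_triangle_ineq[of "x m" "- (t m *\<^sub>R b)" "x n" "- (t n *\<^sub>R b)"]
          M[of m n] N[of m n] that
        by (simp add: dist_norm norm_minus_commute)
      then show "\<exists>M. \<forall>m\<ge>M. \<forall>n\<ge>M. dist (x m - t m *\<^sub>R b) (x n - t n *\<^sub>R b) < e"
        by blast
    qed
    then obtain v where v: "v \<in> span B" "(\<lambda>n. x n - t n *\<^sub>R b) \<longlonglongrightarrow> v"
      using completeE[OF assms, of "\<lambda>n. x n - t n *\<^sub>R b"] t by blast
    have "x \<longlonglongrightarrow> v + s *\<^sub>R b"
      using tendsto_add[OF v(2) tb] by simp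
    moreover have "v + s *\<^sub>R b \<in> span (insert b B)"
      unfolding span_breakdown_eq using v(1) by (intro exI[of _ s]) simp
    ultimately show "\<exists>l\<in>span (insert b B). x \<longlonglongrightarrow> l"
      by blast
  qed
qed

lemma complete_span_finite:
  fixes B :: "'a::real_normed_vector set"
  assumes "finite B"
  shows "complete (span B)"
  \<comment> \<open>The base case is the zero subspace, which is compact.\<close>
  using assms by induction (simp_all add: complete_span_insert compact_imp_complete)

text \<open>Induction on \<open>B\<close>: for a new vector \<open>b\<close>, both parts of the
  splitting x = v + t b are controlled by the norm of x, since \<open>span B\<close> is complete and
  the coefficient bound applies. The induction hypothesis handles f v, and t b contributes at most
  \<open>\<bar>t\<bar> * norm (f b)\<close>.\<close>

lemma linear_bounded_on_span_finite:
  fixes B :: "'a::real_normed_vector set" and f :: "'a \<Rightarrow> 'b::real_normed_vector"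
  assumes f: "linear f" and "finite B"
  shows "\<exists>C. \<forall>x\<in>span B. norm (f x) \<le> C * norm x"
  using \<open>finite B\<close>
proof induction
  case empty
  then show ?case
    using linear_0[OF f] by simp
next
  case (insert b B)
  then obtain C where C: "\<And>x. x \<in> span B \<Longrightarrow> norm (f x) \<le> C * norm x"
    by blast
  show ?case
  proof (cases "b \<in> span B")
    case True
    then show ?thesis
      using C by (metis span_redundant)
  next
    case False
    then obtain d where d: "d > 0" "\<And>x t. x - t *\<^sub>R b \<in> span B \<Longrightarrow> \<bar>t\<bar> * d \<le> norm x"
      using coefficient_bound_complete_subspace[OF subspace_span
          complete_span_finite[OF \<open>finite B\<close>]] by blast
    \<comment> \<open>The factor \<open>1 + norm b / d\<close> bounds the component in
      \<open>span B\<close> relative to \<open>norm x\<close>; the last summand comes from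
      \<open>\<bar>t\<bar> \<le> norm x / d\<close>.\<close>
    let ?K = "\<bar>C\<bar> * (1 + norm b / d) + norm (f b) / d"
    have "norm (f x) \<le> ?K * norm x" if x: "x \<in> span (insert b B)" for x
    proof -
      obtain t where t: "x - t *\<^sub>R b \<in> span B"
        using x unfolding span_breakdown_eq by blast
      have tx: "\<bar>t\<bar> \<le> norm x / d"
        using d(2)[OF t] d(1) by (simp add: field_simps)
      have "norm (x - t *\<^sub>R b) \<le> norm x + \<bar>t\<bar> * norm b"
        by (metis norm_scaleR norm_triangle_ineq4)
      also have "\<dots> \<le> norm x + norm x / d * norm b"
        using mult_right_mono[OF tx norm_ge_zero[of b]] by simp
      finally have v: "norm (x - t *\<^sub>R b) \<le> norm x + norm x / d * norm b" .
      have "f x = f (x - t *\<^sub>R b) + t *\<^sub>R f b"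
        by (simp add: linear_diff[OF f] linear_scale[OF f])
      then have "norm (f x) \<le> norm (f (x - t *\<^sub>R b)) + \<bar>t\<bar> * norm (f b)"
        by (metis norm_scaleR norm_triangle_ineq)
      also have "\<dots> \<le> C * norm (x - t *\<^sub>R b) + norm x / d * norm (f b)"
        by (intro add_mono C[OF t] mult_right_mono tx norm_ge_zero)
      \<comment> \<open>When \<open>span B\<close> is zero, \<open>C\<close> may be negative; the
        estimate \<open>v\<close> can only be multiplied by a nonnegative factor.\<close>
      also have "\<dots> \<le> \<bar>C\<bar> * norm (x - t *\<^sub>R b) + norm x / d * norm (f b)"
        by (simp add: mult_right_mono)
      also have "\<dots> \<le> \<bar>C\<bar> * (norm x + norm x / d * norm b) + norm x / d * norm (f b)"
        using v by (simp add: mult_left_mono)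
      also have "\<dots> = ?K * norm x"
        by (simp add: algebra_simps)
      finally show ?thesis .
    qed
    then show ?thesis
      by blast
  qed
qed

lemma finite_dimensional_bounded_linear:
  fixes f :: "'a::real_normed_vector \<Rightarrow> 'b::real_normed_vector"
  assumes "finite_dimensional TYPE('a)" "linear f"
  shows "bounded_linear f"
proof -
  obtain B :: "'a set" where "finite B" "span B = UNIV"
    using assms(1) unfolding finite_dimensional_def by blast
  then obtain C where "\<And>x. norm (f x) \<le> C * norm x"
    using linear_bounded_on_span_finite[OF assms(2)] by (metis UNIV_I)
  then show ?thesis
    using assms(2)
    by (auto simp: bounded_linear_def bounded_linear_axioms_def mult.commute)
qed

section \<open>Conjugation of differentials and derivatives by an algebra isomorphism\<close>

lemma algebra_iso_inv:
  assumes "algebra_iso \<Psi>"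
  shows "algebra_iso (inv \<Psi>)"
proof -
  have \<Psi>: "linear \<Psi>" "bij \<Psi>" "\<And>x y. \<Psi> (x * y) = \<Psi> x * \<Psi> y" "\<Psi> 1 = 1"
    using assms by (auto simp: algebra_iso_def)
  \<comment> \<open>This turns each identity for the inverse into its image under
    \<open>\<Psi>\<close>, where the homomorphism laws apply.\<close>
  have inv: "inv \<Psi> y = x" if "y = \<Psi> x" for x y
    using that \<Psi>(2) by (simp add: bij_is_inj)
  have right: "\<Psi> (inv \<Psi> y) = y" for y
    using \<Psi>(2) by (simp add: bij_is_surj surj_f_inv_f)
  have "linear (inv \<Psi>)"
    by (intro linearI inv) (simp_all add: linear_add[OF \<Psi>(1)] linear_scale[OF \<Psi>(1)] right)
  moreover have "inv \<Psi> (x * y) = inv \<Psi> x * inv \<Psi> y" for x y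
    by (rule inv) (simp add: \<Psi>(3) right)
  moreover have "inv \<Psi> 1 = 1"
    by (rule inv) (simp add: \<Psi>(4))
  ultimately show ?thesis
    using \<Psi>(2) by (simp add: algebra_iso_def bij_imp_bij_inv)
qed

lemma has_alg_differential_conjugate:
  fixes \<Psi> :: "'a::{real_normed_vector, real_algebra, comm_ring, comm_monoid_mult} \<Rightarrow>
               'b::{real_normed_vector, real_algebra, comm_ring, comm_monoid_mult}"
  assumes "finite_dimensional TYPE('a)" "finite_dimensional TYPE('b)" "algebra_iso \<Psi>"
    and D: "has_alg_differential f D (inv \<Psi> q)"
  shows "has_alg_differential (\<Psi> \<circ> f \<circ> inv \<Psi>) (\<Psi> \<circ> D \<circ> inv \<Psi>) q"
proof -
  have inv: "algebra_iso (inv \<Psi>)"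
    using assms(3) by (rule algebra_iso_inv)
  have \<Psi>: "bounded_linear \<Psi>" and \<Psi>i: "bounded_linear (inv \<Psi>)"
    using assms(1-3) inv by (auto simp: algebra_iso_def intro: finite_dimensional_bounded_linear)
  have right: "\<Psi> (inv \<Psi> y) = y" for y
    using assms(3) by (simp add: algebra_iso_def bij_is_surj surj_f_inv_f)
  have "(f has_derivative D) (at (inv \<Psi> q))"
    using D by (simp add: has_alg_differential_def)
  then have "(f \<circ> inv \<Psi> has_derivative D \<circ> inv \<Psi>) (at q)"
    using diff_chain_at[OF bounded_linear_imp_has_derivative[OF \<Psi>i]] by blast
  then have "(\<Psi> \<circ> (f \<circ> inv \<Psi>) has_derivative \<Psi> \<circ> (D \<circ> inv \<Psi>)) (at q)"
    using bounded_linear_imp_has_derivative[OF \<Psi>] by (rule diff_chain_at)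
  moreover have "(\<Psi> \<circ> D \<circ> inv \<Psi>) (x * y) = (\<Psi> \<circ> D \<circ> inv \<Psi>) x * y" for x y
    using D assms(3) inv by (simp add: has_alg_differential_def algebra_iso_def right)
  ultimately show ?thesis
    by (simp add: has_alg_differential_def comp_assoc)
qed

text \<open>Differentiability is assumed at every point because the second claim equates functions:
  where no differential exists, \<open>alg_deriv\<close> is an unspecified value that need not
  transfer.\<close>

lemma
  fixes \<Psi> :: "'a::{real_normed_vector, real_algebra, comm_ring, comm_monoid_mult} \<Rightarrow>
               'b::{real_normed_vector, real_algebra, comm_ring, comm_monoid_mult}"
  assumes "finite_dimensional TYPE('a)" "finite_dimensional TYPE('b)" "algebra_iso \<Psi>"
    and f: "\<And>p. alg_differentiable f p"
  shows alg_differentiable_conjugate: "alg_differentiable (\<Psi> \<circ> f \<circ> inv \<Psi>) q"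
    and alg_deriv_conjugate: "alg_deriv (\<Psi> \<circ> f \<circ> inv \<Psi>) = \<Psi> \<circ> alg_deriv f \<circ> inv \<Psi>"
proof -
  show "alg_differentiable (\<Psi> \<circ> f \<circ> inv \<Psi>) q"
    using f has_alg_differential_conjugate[OF assms(1-3)] unfolding alg_differentiable_def by blast
  show "alg_deriv (\<Psi> \<circ> f \<circ> inv \<Psi>) = \<Psi> \<circ> alg_deriv f \<circ> inv \<Psi>"
  proof
    fix q
    obtain D where D: "has_alg_differential f D (inv \<Psi> q)"
      using f unfolding alg_differentiable_def by blast
    \<comment> \<open>Preservation of the unit makes the conjugated differential at 1 equal to
      \<open>\<Psi> (D 1)\<close>.\<close>
    have "inv \<Psi> 1 = 1"
      using algebra_iso_inv[OF assms(3)] by (simp add: algebra_iso_def)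
    then show "alg_deriv (\<Psi> \<circ> f \<circ> inv \<Psi>) q = (\<Psi> \<circ> alg_deriv f \<circ> inv \<Psi>) q"
      using alg_deriv_eq[OF D] alg_deriv_eq[OF has_alg_differential_conjugate[OF assms(1-3) D]]
      by simp
  qed
qed

text \<open>Passing from \<open>k\<close> to \<open>Suc k \<le> n\<close> needs differentiability of
  the \<open>k\<close>-th derivative only, so the hypothesis for orders below \<open>n\<close>
  reaches the \<open>n\<close>-th derivative as well.\<close>

lemma iterated_alg_deriv_conjugate:
  fixes \<Psi> :: "'a::{real_normed_vector, real_algebra, comm_ring, comm_monoid_mult} \<Rightarrow>
               'b::{real_normed_vector, real_algebra, comm_ring, comm_monoid_mult}"
  assumes "finite_dimensional TYPE('a)" "finite_dimensional TYPE('b)" "algebra_iso \<Psi>"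
    and "n_times_alg_differentiable n f" "k \<le> n"
  shows "(alg_deriv ^^ k) (\<Psi> \<circ> f \<circ> inv \<Psi>) = \<Psi> \<circ> (alg_deriv ^^ k) f \<circ> inv \<Psi>"
  using assms(5)
proof (induction k)
  case (Suc k)
  then have "alg_differentiable ((alg_deriv ^^ k) f) p" for p
    using assms(4) by (simp add: n_times_alg_differentiable_def)
  then show ?case
    using Suc.IH[OF Suc_leD[OF Suc.prems]]
      alg_deriv_conjugate[OF assms(1-3), of "(alg_deriv ^^ k) f"]
    by (metis funpow.simps(2) o_apply)
qed simp

theorem theorem5p12:
  fixes \<Psi> :: "'a::{real_normed_vector, real_algebra, comm_ring, comm_monoid_mult} \<Rightarrow>
               'b::{real_normed_vector, real_algebra, comm_ring, comm_monoid_mult}"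
    and n :: nat
    and a :: "nat \<Rightarrow> 'a"
    and \<eta> :: "'a \<Rightarrow> 'a"
    and w :: "'b \<Rightarrow> 'b"
  assumes "finite_dimensional TYPE('a)"
    and "finite_dimensional TYPE('b)"
    and "algebra_iso \<Psi>"
    and "n_times_alg_differentiable n \<eta>"
    and "w = \<Psi> \<circ> \<eta> \<circ> inv \<Psi>"
  shows "solves_linear_ode n a \<eta> \<longleftrightarrow>
         n_times_alg_differentiable n w \<and> solves_linear_ode n (\<Psi> \<circ> a) w"
proof -
  have iter: "(alg_deriv ^^ k) w = \<Psi> \<circ> (alg_deriv ^^ k) \<eta> \<circ> inv \<Psi>" if "k \<le> n" for k
    using iterated_alg_deriv_conjugate[OF assms(1-4) that] assms(5) by simp
  have "n_times_alg_differentiable n w"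
    \<comment> \<open>Differentiability of \<open>w\<close> follows from that of
      \<open>\<eta>\<close> without the equation, so only the two equations remain to be
      compared.\<close>
    using assms(4) alg_differentiable_conjugate[OF assms(1-3)]
    by (simp add: n_times_alg_differentiable_def iter)
  moreover have "solves_linear_ode n (\<Psi> \<circ> a) w \<longleftrightarrow> solves_linear_ode n a \<eta>"
  proof -
    have \<Psi>: "linear \<Psi>" "bij \<Psi>" "\<And>x y. \<Psi> (x * y) = \<Psi> x * \<Psi> y"
      using assms(3) by (auto simp: algebra_iso_def)
    let ?E = "\<lambda>z. \<Sum>k\<le>n. a k * (alg_deriv ^^ k) \<eta> z"
    have "(\<Sum>k\<le>n. (\<Psi> \<circ> a) k * (alg_deriv ^^ k) w q) = \<Psi> (?E (inv \<Psi> q))" for q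
      by (simp add: linear_sum[OF \<Psi>(1)] \<Psi>(3) iter)
    \<comment> \<open>Injectivity lets the sum vanish exactly when its image does; surjectivity of
      \<open>inv \<Psi>\<close> then makes testing all \<open>q\<close> the same as testing all
      \<open>z\<close>.\<close>
    moreover have "\<Psi> x = 0 \<longleftrightarrow> x = 0" for x
      using \<Psi>(1,2) by (metis bij_is_inj injD linear_0)
    moreover have "(\<forall>q. ?E (inv \<Psi> q) = 0) \<longleftrightarrow> (\<forall>z. ?E z = 0)"
      using \<Psi>(2) by (metis bij_inv_eq_iff)
    ultimately show ?thesis
      by (simp add: solves_linear_ode_def)
  qed
  ultimately show ?thesis
    by blast
qed

end
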